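(* Let $G$ be a partially ordered abelian group, $U\subseteq G$ and $x\in U$. (i) $U$ is a net catching set for $0$ if and only if for every net $(x_\alpha)_{\alpha\in A}$ in $G$ with $x_\alpha\downarrow0$ there is $\alpha\in A$ such that $[-x_\alpha,x_\alpha]\subseteq U$. (ii) $U$ is a net catching set for $x$ if and only if $U-x$ is a net catching set for $0$.
   Context: A partially ordered abelian group is an abelian group with a translation invariant partial order. Nets are indexed by non-empty upward directed partially ordered sets. $x_\alpha\downarrow x$ means that $x_\alpha\le x_\beta$ whenever $\alpha\ge\beta$ and $\inf_\alpha x_\alpha=x$; $x_\alpha\uparrow x$ is defined dually. $[a,b]:=\{z\in G;\ a\le z\le b\}$ and $U-x=\{u-x;\ u\in U\}$. A subset $U\subseteq G$ is a net catching set for $x\in G$ if for all nets $(\hat x_\alpha)_{\alpha\in A}$ and $(\check x_\alpha)_{\alpha\in A}$ in $G$ (with the same index set) with $\hat x_\alpha\uparrow x$ and $\check x_\alpha\downarrow x$ there is $\alpha\in A$ such that $[\hat x_\alpha,\check x_\alpha]\subseteq U$. *)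

theory Defs
  imports Main "HOL-Library.Lub_Glb"
begin

text \<open>
  An index set is a partially ordered set \<open>A\<close> with order relation \<open>r\<close>, where \<open>(\<alpha>, \<beta>) \<in> r\<close> means
  \<open>\<alpha> \<le> \<beta>\<close>. A net indexed by \<open>A\<close> is a function of which only the values on \<open>A\<close> matter.
\<close>

definition net_index :: "'i set \<Rightarrow> 'i rel \<Rightarrow> bool" where
  "net_index A r \<longleftrightarrow>
     A \<noteq> {} \<and> partial_order_on A r \<and>
     (\<forall>\<alpha>\<in>A. \<forall>\<beta>\<in>A. \<exists>\<gamma>\<in>A. (\<alpha>, \<gamma>) \<in> r \<and> (\<beta>, \<gamma>) \<in> r)"

definition net_down :: "'i set \<Rightarrow> 'i rel \<Rightarrow> ('i \<Rightarrow> 'g::order) \<Rightarrow> 'g \<Rightarrow> bool" where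
  "net_down A r f x \<longleftrightarrow>
     (\<forall>\<alpha>\<in>A. \<forall>\<beta>\<in>A. (\<beta>, \<alpha>) \<in> r \<longrightarrow> f \<alpha> \<le> f \<beta>) \<and> isGlb UNIV (f ` A) x"

definition net_up :: "'i set \<Rightarrow> 'i rel \<Rightarrow> ('i \<Rightarrow> 'g::order) \<Rightarrow> 'g \<Rightarrow> bool" where
  "net_up A r f x \<longleftrightarrow>
     (\<forall>\<alpha>\<in>A. \<forall>\<beta>\<in>A. (\<beta>, \<alpha>) \<in> r \<longrightarrow> f \<beta> \<le> f \<alpha>) \<and> isLub UNIV (f ` A) x"

text \<open>
  HOL cannot quantify over all index sets of all types within a formula, so the type \<open>'i\<close> from
  which index sets are drawn is a parameter, and statements are made for every \<open>'i\<close>. By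
  \<open>net_catching_any_index_type\<close> below, \<open>'i = 'g \<times> 'g\<close> already accounts for all index types, so
  \<open>net_catching TYPE('g \<times> 'g)\<close> is the unrestricted notion.
\<close>

definition net_catching :: "'i itself \<Rightarrow> 'g::ordered_ab_group_add set \<Rightarrow> 'g \<Rightarrow> bool" where
  "net_catching (_ :: 'i itself) U x \<longleftrightarrow>
     (\<forall>(A :: 'i set) r f g.
        net_index A r \<and> net_up A r f x \<and> net_down A r g x \<longrightarrow>
        (\<exists>\<alpha>\<in>A. {f \<alpha>..g \<alpha>} \<subseteq> U))"

lemma net_catching_any_index_type:
  fixes U :: "'g::ordered_ab_group_add set"
  assumes U: "net_catching TYPE('g \<times> 'g) U x"
  shows "net_catching TYPE('i) U x"
  unfolding net_catching_def
proof (intro allI impI)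
  fix A :: "'i set" and r and f g :: "'i \<Rightarrow> 'g"
  assume *: "net_index A r \<and> net_up A r f x \<and> net_down A r g x"
  define B where "B = (\<lambda>\<alpha>. (f \<alpha>, g \<alpha>)) ` A"
  define s where "s = {(p, q). p \<in> B \<and> q \<in> B \<and> fst p \<le> fst q \<and> snd q \<le> snd p}"
  have img: "fst ` B = f ` A" "snd ` B = g ` A"
    by (auto simp: B_def image_image)
  have ord: "partial_order_on B s"
    by (auto simp: order_on_defs s_def refl_on_def intro!: transI antisymI)
  have dir: "\<exists>q\<in>B. (p, q) \<in> s \<and> (p', q) \<in> s" if pp: "p \<in> B" "p' \<in> B" for p p'
  proof -
    obtain \<alpha> \<beta> where ab: "\<alpha> \<in> A" "\<beta> \<in> A" "p = (f \<alpha>, g \<alpha>)" "p' = (f \<beta>, g \<beta>)"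
      using pp by (auto simp: B_def)
    then obtain \<gamma> where c: "\<gamma> \<in> A" "(\<alpha>, \<gamma>) \<in> r" "(\<beta>, \<gamma>) \<in> r"
      using * unfolding net_index_def by blast
    then have "f \<alpha> \<le> f \<gamma>" "f \<beta> \<le> f \<gamma>" "g \<gamma> \<le> g \<alpha>" "g \<gamma> \<le> g \<beta>"
      using * ab unfolding net_up_def net_down_def by blast+
    then show ?thesis
      using ab c by (intro bexI[of _ "(f \<gamma>, g \<gamma>)"]) (auto simp: s_def B_def)
  qed
  have "net_index B s"
    using * ord dir by (auto simp: net_index_def B_def)
  moreover have "net_up B s fst x" "net_down B s snd x"
    using * by (auto simp: net_up_def net_down_def img) (auto simp: s_def)
  ultimately obtain p where "p \<in> B" "{fst p..snd p} \<subseteq> U"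
    using U unfolding net_catching_def by blast
  then obtain \<alpha> where "\<alpha> \<in> A" "{f \<alpha>..g \<alpha>} \<subseteq> U"
    unfolding B_def by (elim imageE) (simp only: fst_conv snd_conv)
  then show "\<exists>\<alpha>\<in>A. {f \<alpha>..g \<alpha>} \<subseteq> U" ..
qed

end

theory Submission
  imports Defs
begin

text \<open>
  For the nontrivial half of (i), the differences of a net decreasing to \<open>0\<close> and one increasing
  to \<open>0\<close> again decrease to \<open>0\<close>, and the symmetric interval of the difference contains the interval
  between the two nets. Part (ii) holds because translations preserve nets, bounds and intervals.
\<close>

lemma isGlb_UNIV_image_iff:
  "isGlb UNIV (f ` A) x \<longleftrightarrow> (\<forall>\<alpha>\<in>A. x \<le> f \<alpha>) \<and> (\<forall>z. (\<forall>\<alpha>\<in>A. z \<le> f \<alpha>) \<longrightarrow> z \<le> x)"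
  by (auto simp: isGlb_def greatestP_def isLb_def setge_def setle_def)

lemma isLub_UNIV_image_iff:
  "isLub UNIV (f ` A) x \<longleftrightarrow> (\<forall>\<alpha>\<in>A. f \<alpha> \<le> x) \<and> (\<forall>z. (\<forall>\<alpha>\<in>A. f \<alpha> \<le> z) \<longrightarrow> x \<le> z)"
  by (auto simp: isLub_def leastP_def isUb_def setge_def setle_def)

lemma net_up_uminus:
  fixes f :: "'i \<Rightarrow> 'g::ordered_ab_group_add"
  assumes "net_down A r f x"
  shows "net_up A r (\<lambda>\<alpha>. - f \<alpha>) (- x)"
  using assms unfolding net_up_def net_down_def isGlb_UNIV_image_iff isLub_UNIV_image_iff
  by (auto simp: minus_le_iff)

lemma net_down_add_const:
  fixes f :: "'i \<Rightarrow> 'g::ordered_ab_group_add"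
  assumes "net_down A r f x"
  shows "net_down A r (\<lambda>\<alpha>. f \<alpha> + c) (x + c)"
  using assms unfolding net_down_def isGlb_UNIV_image_iff
  \<comment> \<open>The flipped rule moves \<open>c\<close> onto the competing lower bound:
    \<open>z\<close> bounds the shifted net from below exactly when \<open>z - c\<close> bounds
    \<open>f\<close> from below.\<close>
  by (auto simp flip: diff_le_eq)

lemma net_up_add_const:
  fixes f :: "'i \<Rightarrow> 'g::ordered_ab_group_add"
  assumes "net_up A r f x"
  shows "net_up A r (\<lambda>\<alpha>. f \<alpha> + c) (x + c)"
  using assms unfolding net_up_def isLub_UNIV_image_iff
  by (auto simp flip: le_diff_eq)

text \<open>Directedness decouples the indices: a lower bound of the differences at equal indices
  also bounds \<open>g \<beta> - f \<alpha>\<close> for independent \<open>\<alpha>\<close> and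
  \<open>\<beta>\<close>, so the infimum of \<open>g\<close> and the supremum of \<open>f\<close>
  can be taken one after the other.\<close>

lemma net_down_diff:
  fixes f g :: "'i \<Rightarrow> 'g::ordered_ab_group_add"
  assumes A: "net_index A r" and f: "net_up A r f x" and g: "net_down A r g y"
  shows "net_down A r (\<lambda>\<alpha>. g \<alpha> - f \<alpha>) (y - x)"
proof -
  have "z \<le> y - x" if z: "\<forall>\<alpha>\<in>A. z \<le> g \<alpha> - f \<alpha>" for z
  proof -
    have le: "z + f \<alpha> \<le> g \<beta>" if ab: "\<alpha> \<in> A" "\<beta> \<in> A" for \<alpha> \<beta>
    proof -
      \<comment> \<open>At a common upper index \<open>\<gamma>\<close> the gap between the nets is
        smallest: \<open>f\<close> has grown and \<open>g\<close> has dropped.\<close>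
      obtain \<gamma> where c: "\<gamma> \<in> A" "(\<alpha>, \<gamma>) \<in> r" "(\<beta>, \<gamma>) \<in> r"
        using A ab unfolding net_index_def by blast
      then have "f \<alpha> \<le> f \<gamma>" "g \<gamma> \<le> g \<beta>"
        using f g ab unfolding net_up_def net_down_def by blast+
      moreover have "z + f \<gamma> \<le> g \<gamma>"
        using z c(1) by (simp add: le_diff_eq)
      ultimately show ?thesis
        by (meson add_left_mono order_trans)
    qed
    \<comment> \<open>With \<open>\<alpha>\<close> fixed, \<open>z + f \<alpha>\<close> is a lower
      bound of all values of \<open>g\<close>, hence lies below the infimum
      \<open>y\<close>.\<close>
    have "\<forall>\<alpha>\<in>A. z + f \<alpha> \<le> y"
      using g le unfolding net_down_def isGlb_UNIV_image_iff by blast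
    then have "\<forall>\<alpha>\<in>A. f \<alpha> \<le> y - z"
      by (simp add: le_diff_eq add.commute)
    then have "x \<le> y - z"
      using f unfolding net_up_def isLub_UNIV_image_iff by blast
    then show ?thesis
      by (simp add: le_diff_eq add.commute)
  qed
  then show ?thesis
    using f g unfolding net_up_def net_down_def isGlb_UNIV_image_iff isLub_UNIV_image_iff
    by (auto intro: diff_mono)
qed

lemma net_catching_0_iff:
  fixes U :: "'g::ordered_ab_group_add set"
  shows "net_catching TYPE('i) U 0 \<longleftrightarrow>
    (\<forall>(A :: 'i set) r f. net_index A r \<and> net_down A r f 0 \<longrightarrow>
       (\<exists>\<alpha>\<in>A. {- f \<alpha>..f \<alpha>} \<subseteq> U))" (is "?L \<longleftrightarrow> ?R")
proof
  assume L: ?L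
  show ?R
  proof (intro allI impI)
    fix A :: "'i set" and r and f :: "'i \<Rightarrow> 'g"
    assume *: "net_index A r \<and> net_down A r f 0"
    then have "net_up A r (\<lambda>\<alpha>. - f \<alpha>) 0"
      using net_up_uminus[of A r f 0] by simp
    with * L show "\<exists>\<alpha>\<in>A. {- f \<alpha>..f \<alpha>} \<subseteq> U"
      unfolding net_catching_def by blast
  qed
next
  assume R: ?R
  show ?L
    unfolding net_catching_def
  proof (intro allI impI)
    fix A :: "'i set" and r and f g :: "'i \<Rightarrow> 'g"
    assume *: "net_index A r \<and> net_up A r f 0 \<and> net_down A r g 0"
    then have "net_down A r (\<lambda>\<alpha>. g \<alpha> - f \<alpha>) 0"
      using net_down_diff[of A r f 0 g 0] by simp
    then obtain \<alpha> where a: "\<alpha> \<in> A" "{- (g \<alpha> - f \<alpha>)..g \<alpha> - f \<alpha>} \<subseteq> U"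
      using R * by blast
    \<comment> \<open>These signs give the inclusion of intervals:
      \<open>f \<alpha> - g \<alpha> \<le> f \<alpha>\<close> and
      \<open>g \<alpha> \<le> g \<alpha> - f \<alpha>\<close>.\<close>
    have "f \<alpha> \<le> 0" "0 \<le> g \<alpha>"
      using * a(1) unfolding net_up_def net_down_def isGlb_UNIV_image_iff isLub_UNIV_image_iff
      by blast+
    then have "{f \<alpha>..g \<alpha>} \<subseteq> {- (g \<alpha> - f \<alpha>)..g \<alpha> - f \<alpha>}"
      by (simp add: diff_le_eq le_diff_eq add_increasing add_increasing2 add_decreasing2)
    with a show "\<exists>\<alpha>\<in>A. {f \<alpha>..g \<alpha>} \<subseteq> U"
      by blast
  qed
qed

text \<open>Nets converging to \<open>x + c\<close> are shifted back to \<open>x\<close>, caught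
  there by \<open>U\<close>, and the caught interval is shifted forward again. As \<open>c\<close>
  is arbitrary, one implication serves both directions of (ii), with \<open>c = - x\<close> and
  \<open>c = x\<close>.\<close>

lemma net_catching_translate:
  fixes U :: "'g::ordered_ab_group_add set"
  assumes U: "net_catching TYPE('i) U x"
  shows "net_catching TYPE('i) ((\<lambda>u. u + c) ` U) (x + c)"
  unfolding net_catching_def
proof (intro allI impI)
  fix A :: "'i set" and r and f g :: "'i \<Rightarrow> 'g"
  assume *: "net_index A r \<and> net_up A r f (x + c) \<and> net_down A r g (x + c)"
  then have "net_up A r (\<lambda>\<alpha>. f \<alpha> + - c) x" "net_down A r (\<lambda>\<alpha>. g \<alpha> + - c) x"
    using net_up_add_const[of A r f "x + c" "- c"] net_down_add_const[of A r g "x + c" "- c"]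
    by simp_all
  then obtain \<alpha> where a: "\<alpha> \<in> A" "{f \<alpha> + - c..g \<alpha> + - c} \<subseteq> U"
    using U * unfolding net_catching_def by blast
  have "z \<in> (\<lambda>u. u + c) ` U" if "z \<in> {f \<alpha>..g \<alpha>}" for z
  proof (rule image_eqI)
    show "z = (z - c) + c" by simp
    show "z - c \<in> U" using that a(2) by (auto intro!: diff_right_mono)
  qed
  with a(1) show "\<exists>\<alpha>\<in>A. {f \<alpha>..g \<alpha>} \<subseteq> (\<lambda>u. u + c) ` U"
    by blast
qed

theorem proposition5p1:
  fixes U :: "'g::ordered_ab_group_add set" and x :: 'g
  assumes "x \<in> U"
  shows "(net_catching TYPE('i) U 0 \<longleftrightarrow>
            (\<forall>(A :: 'i set) r f. net_index A r \<and> net_down A r f 0 \<longrightarrow>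
               (\<exists>\<alpha>\<in>A. {- f \<alpha>..f \<alpha>} \<subseteq> U))) \<and>
         (net_catching TYPE('i) U x \<longleftrightarrow> net_catching TYPE('i) ((\<lambda>u. u - x) ` U) 0)"
proof (intro conjI iffI)
  assume "net_catching TYPE('i) U x"
  from net_catching_translate[OF this, of "- x"]
  show "net_catching TYPE('i) ((\<lambda>u. u - x) ` U) 0" by simp
next
  assume "net_catching TYPE('i) ((\<lambda>u. u - x) ` U) 0"
  \<comment> \<open>Shifting by \<open>x\<close> undoes the shift by \<open>- x\<close>, so the
    composed image is \<open>U\<close> itself.\<close>
  from net_catching_translate[OF this, of x]
  show "net_catching TYPE('i) U x" by (simp add: image_image)
qed (use net_catching_0_iff[of U, where 'i = 'i] in blast)+

end
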